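(* Let $m$ and $d$ be positive integers with $d\geq 2$. For any $d$-dimensional convex body $K\subset\mathbb{E}^d$, we have $$I^m(K)\geq 2m+(d-1).$$
   Context: $\mathbb{E}^d$ is $d$-dimensional Euclidean space and $\mathbb{S}^{d-1}$ is its origin-centered unit sphere. A $d$-dimensional convex body is a compact convex subset of $\mathbb{E}^d$ with nonempty interior; $\partial K$ and $\operatorname{int}(K)$ denote boundary and interior. A direction $u\in\mathbb{S}^{d-1}$ illuminates a point $p\in\partial K$ with respect to $K$ if $p+\lambda u\in\operatorname{int}(K)$ for some $\lambda>0$. $K$ is $m$-fold illuminated by a finite multiset $U$ of directions in $\mathbb{S}^{d-1}$ if each point of $\partial K$ is illuminated by at least $m$ members of $U$ (counted with multiplicity) with respect to $K$. The $m$-fold illumination number $I^m(K)$ is the smallest cardinality (counted with multiplicity) of a multiset of directions that $m$-fold illuminates $K$. *)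

theory Defs
  imports "HOL-Analysis.Analysis" "HOL-Library.Multiset"
begin

definition convex_body :: "'a::euclidean_space set \<Rightarrow> bool" where
  "convex_body K \<longleftrightarrow> compact K \<and> convex K \<and> interior K \<noteq> {}"

text \<open>Meant for a unit vector \<open>u\<close> and a point \<open>p\<close> of \<open>frontier K\<close>; these domain conditions
  are imposed where the notion is used.\<close>

definition illuminates :: "'a::euclidean_space set \<Rightarrow> 'a \<Rightarrow> 'a \<Rightarrow> bool" where
  "illuminates K u p \<longleftrightarrow> (\<exists>t>0. p + t *\<^sub>R u \<in> interior K)"

definition fold_illuminated :: "nat \<Rightarrow> 'a::euclidean_space set \<Rightarrow> 'a multiset \<Rightarrow> bool" where
  "fold_illuminated m K U \<longleftrightarrow>
     set_mset U \<subseteq> sphere 0 1 \<and>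
     (\<forall>p\<in>frontier K. m \<le> size {#u \<in># U. illuminates K u p#})"

text \<open>For a convex body \<open>K\<close> some multiset satisfies the condition (by compactness of
  \<open>frontier K\<close>), so that the minimum exists; a lower bound on \<open>LEAST\<close> relies on this.\<close>

definition illumination_number :: "nat \<Rightarrow> 'a::euclidean_space set \<Rightarrow> nat" where
  "illumination_number m K = (LEAST n. \<exists>U. fold_illuminated m K U \<and> size U = n)"

end

theory Submission
  imports Defs
begin

text \<open>For \<open>v \<noteq> 0\<close>, a point of \<open>K\<close> maximising \<open>inner v\<close> is illuminated only by directions \<open>u\<close>
  with \<open>v \<bullet> u < 0\<close>, so every open half-space bounded by a hyperplane through the origin contains
  at least \<open>m\<close> of the directions. Take a hyperplane through the origin and \<open>d - 1\<close> of the
  directions: the two open half-spaces contain \<open>m\<close> further directions each.\<close>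

text \<open>This makes the \<open>LEAST\<close> in \<open>illumination_number\<close> an attained
  minimum. The direction from a boundary point \<open>p\<close> to a fixed interior point
  \<open>x\<close> also illuminates all boundary points near \<open>p\<close>, so by compactness
  finitely many directions suffice.\<close>

lemma fold_illuminated_exists:
  fixes K :: "'a::euclidean_space set"
  assumes "convex_body K"
  shows "\<exists>U. fold_illuminated m K U"
proof -
  obtain x where x: "x \<in> interior K"
    using assms by (auto simp: convex_body_def)
  \<comment> \<open>An open neighbourhood of \<open>p\<close>, since \<open>p\<close> itself is
    moved to \<open>x\<close>. Each of its points reaches the interior along the same vector
    \<open>x - p\<close>.\<close>
  define N where "N p = (\<lambda>q. q + (x - p)) -` interior K" for p
  have "open (N p)" for p
    unfolding N_def by (intro continuous_open_vimage continuous_intros) auto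
  moreover have "compact (frontier K)"
    using assms by (simp add: convex_body_def compact_frontier)
  moreover have "frontier K \<subseteq> (\<Union>p\<in>frontier K. N p)"
    using x by (auto simp: N_def)
  ultimately obtain D where D: "D \<subseteq> frontier K" "finite D" "frontier K \<subseteq> (\<Union>p\<in>D. N p)"
    by (metis compactE_image)
  \<comment> \<open>Each distinct direction gets multiplicity \<open>m\<close>, so one illuminating
    direction per boundary point is enough.\<close>
  define U where "U = repeat_mset m (mset_set ((\<lambda>p. sgn (x - p)) ` D))"
  have ne: "x \<noteq> p" if "p \<in> D" for p
    using that D(1) x by (auto simp: frontier_def)
  have "set_mset U \<subseteq> sphere 0 1"
  proof -
    have "set_mset U \<subseteq> (\<lambda>p. sgn (x - p)) ` D"
      using D(2) by (auto simp: U_def set_mset_def count_mset_set' split: if_splits)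
    then show ?thesis
      using ne by (auto simp: norm_sgn)
  qed
  moreover have "m \<le> size {#u \<in># U. illuminates K u q#}" if "q \<in> frontier K" for q
  proof -
    obtain p where p: "p \<in> D" "q + (x - p) \<in> interior K"
      using D(3) \<open>q \<in> frontier K\<close> by (auto simp: N_def)
    have "illuminates K (sgn (x - p)) q"
      unfolding illuminates_def
      using p ne by (intro exI[of _ "norm (x - p)"]) (simp add: sgn_div_norm)
    then have "m \<le> count {#u \<in># U. illuminates K u q#} (sgn (x - p))"
      using p(1) D(2) by (simp add: U_def)
    then show ?thesis
      by (metis count_le_size le_trans)
  qed
  ultimately show ?thesis
    unfolding fold_illuminated_def by blast
qed

lemma fold_illuminated_halfspace:
  fixes K :: "'a::euclidean_space set"
  assumes "convex_body K" and "fold_illuminated m K U" and "v \<noteq> 0"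
  shows "m \<le> size {#u \<in># U. v \<bullet> u < 0#}"
proof -
  have "compact K" "K \<noteq> {}"
    using assms(1) interior_subset by (auto simp: convex_body_def)
  then obtain p where p: "p \<in> K" "\<And>y. y \<in> K \<Longrightarrow> v \<bullet> y \<le> v \<bullet> p"
    using continuous_attains_sup[of K "\<lambda>y. v \<bullet> y"] continuous_on_inner[OF continuous_on_const continuous_on_id]
    by metis
  have less: "v \<bullet> y < v \<bullet> p" if "y \<in> interior K" for y
  proof -
    obtain e where e: "e > 0" "cball y e \<subseteq> K"
      using \<open>y \<in> interior K\<close> unfolding mem_interior_cball by blast
    \<comment> \<open>Moving from \<open>y\<close> by \<open>e\<close> along \<open>sgn v\<close>
      stays in \<open>K\<close> and raises the functional by \<open>e * norm v\<close>, which makes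
      the inequality strict.\<close>
    have "y + e *\<^sub>R sgn v \<in> K"
      using e assms(3) by (intro subsetD[OF e(2)]) (auto simp: dist_norm norm_sgn)
    then have "v \<bullet> y + e * norm v \<le> v \<bullet> p"
      using p(2)[of "y + e *\<^sub>R sgn v"] assms(3)
      by (simp add: inner_add_right sgn_div_norm dot_square_norm power2_eq_square field_simps)
    moreover have "e * norm v > 0"
      using e assms(3) by simp
    ultimately show ?thesis by linarith
  qed
  \<comment> \<open>If \<open>p\<close> were interior, \<open>less\<close> would give
    \<open>v \<bullet> p < v \<bullet> p\<close>.\<close>
  have "p \<in> frontier K"
    using p(1) less[of p] closure_subset by (auto simp: frontier_def)
  then have "m \<le> size {#u \<in># U. illuminates K u p#}"
    using assms(2) by (simp add: fold_illuminated_def)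
  also have "\<dots> \<le> size {#u \<in># U. v \<bullet> u < 0#}"
  proof (intro size_mset_mono filter_mset_mono_strong subset_mset.order_refl)
    show "v \<bullet> u < 0" if "illuminates K u p" for u
    proof -
      obtain t where "t > 0" "p + t *\<^sub>R u \<in> interior K"
        using \<open>illuminates K u p\<close> by (auto simp: illuminates_def)
      with less[of "p + t *\<^sub>R u"] show ?thesis
        by (simp add: inner_add_right mult_less_0_iff)
    qed
  qed
  finally show ?thesis .
qed

lemma size_ge_if_halfspaces:
  fixes U :: "'a::euclidean_space multiset"
  assumes "m \<ge> 1" and half: "\<And>v. v \<noteq> 0 \<Longrightarrow> m \<le> size {#u \<in># U. v \<bullet> u < 0#}"
  shows "2 * m + (DIM('a) - 1) \<le> size U"
proof -
  obtain xs where xs: "mset xs = U"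
    using ex_mset by blast
  \<comment> \<open>If \<open>U\<close> has fewer than \<open>DIM('a) - 1\<close> members,
    \<open>take\<close> returns all of them; the last step excludes this case.\<close>
  define A where "A = mset (take (DIM('a) - 1) xs)"
  have "A \<subseteq># U"
    unfolding A_def xs[symmetric] by (metis append_take_drop_id mset_append mset_subset_eq_add_left)
  have size_A: "size A = min (size U) (DIM('a) - 1)"
    by (auto simp: A_def xs[symmetric])
  \<comment> \<open>The span of \<open>A\<close> is a proper subspace, so some nonzero
    \<open>v\<close> is orthogonal to it; \<open>v\<close> is the normal of the hyperplane.\<close>
  have "dim (set_mset A) \<le> card (set_mset A)"
    by (intro dim_le_card') auto
  also have "\<dots> \<le> DIM('a) - 1"
    unfolding A_def by (metis card_length length_take min.cobounded2 le_trans set_mset_mset)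
  also have "\<dots> < DIM('a)"
    by simp
  finally obtain v where v: "v \<noteq> 0" "\<And>y. y \<in> span (set_mset A) \<Longrightarrow> orthogonal v y"
    using orthogonal_to_subspace_exists by metis
  have zero: "size A \<le> size {#u \<in># U. v \<bullet> u = 0#}"
  proof (intro size_mset_mono)
    have "A = {#u \<in># A. v \<bullet> u = 0#}"
      using v(2)[OF span_base] by (intro multiset_eqI) (auto simp: orthogonal_def count_eq_zero_iff)
    then show "A \<subseteq># {#u \<in># U. v \<bullet> u = 0#}"
      using \<open>A \<subseteq># U\<close> by (metis multiset_filter_mono)
  qed
  have "U = {#u \<in># U. v \<bullet> u < 0#} + {#u \<in># U. - v \<bullet> u < 0#} + {#u \<in># U. v \<bullet> u = 0#}"
    by (rule multiset_eqI) auto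
  then have "size U = size {#u \<in># U. v \<bullet> u < 0#} + size {#u \<in># U. - v \<bullet> u < 0#}
      + size {#u \<in># U. v \<bullet> u = 0#}"
    by (metis size_union)
  then have "2 * m + size A \<le> size U"
    using half[of v] half[of "- v"] v(1) zero by auto
  \<comment> \<open>If \<open>A\<close> exhausted \<open>U\<close>, then
    \<open>2 * m + size U \<le> size U\<close>, contradicting \<open>m \<ge> 1\<close>. Hence
    \<open>size A = DIM('a) - 1\<close>.\<close>
  then show ?thesis
    using size_A \<open>m \<ge> 1\<close> by (auto simp: min_def split: if_splits)
qed

theorem theorem1p5:
  fixes m d :: nat and K :: "'a::euclidean_space set"
  assumes "m \<ge> 1" and "d \<ge> 2" and "DIM('a) = d"
    and "convex_body K"
  shows "illumination_number m K \<ge> 2 * m + (d - 1)"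
proof -
  have "\<exists>n U. fold_illuminated m K U \<and> size U = n"
    using fold_illuminated_exists[OF assms(4)] by blast
  from LeastI_ex[OF this] obtain U
    where "fold_illuminated m K U" "size U = illumination_number m K"
    unfolding illumination_number_def by blast
  with size_ge_if_halfspaces[of m U] fold_illuminated_halfspace[OF assms(4)] assms
  show ?thesis
    by metis
qed

end
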